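(* Let $F^\star=\inf_{x\in\mathbb{R}^n}F(x)$, let $t=1/L$, and let $x^0\in\mathbb{R}^n$ be an initial point. (a) Let $\rho_l>0$ and let $\{x^k\}_{k\in\mathbb{N}}\subset\mathbb{R}^n$ be any sequence starting at $x^0$ such that for every $k\in\mathbb{N}$ $$F_t(x^{k+1};x^k)-\min_{x\in\mathbb{R}^n}F_t(x;x^k)\le\rho_l\left(F_t(x^k;x^k)-F_t(x^{k+1};x^k)\right).$$ Then for every $\epsilon>0$ an $\epsilon$-stationary point is found within $$\left\lfloor\frac{2(1+\rho_l)(F(x^0)-F^\star)}{t\epsilon^2}\right\rfloor$$ iterations; that is, there is an index $k$ not exceeding this number such that $x^k$ is an $\epsilon$-stationary point. (b) Let $0<\rho_h<1/4$ and let $\{x^k\}_{k\in\mathbb{N}}\subset\mathbb{R}^n$ be any sequence starting at $x^0$ such that for every $k\in\mathbb{N}$ $$F_t(x^{k+1};x^k)-\min_{x\in\mathbb{R}^n}F_t(x;x^k)\le\frac{\rho_h}{2t}\|x^{k+1}-x^k\|_2^2.$$ Then for every $\epsilon>0$ an $\epsilon$-stationary point is found within $$\left\lfloor\frac{2(1-\sqrt{\rho_h})^2(F(x^0)-F^\star)}{(1-2\sqrt{\rho_h})t\epsilon^2}\right\rfloor$$ iterations; that is, there is an index $k$ not exceeding this number such that $x^k$ is an $\epsilon$-stationary point.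
   Context: Let $m,n\ge1$, $a_1,\dots,a_m\in\mathbb{R}^n$, let $A\in\mathbb{R}^{m\times n}$ be the matrix with rows $a_i^\top$, $A\neq0$, and let $b\in\mathbb{R}^m$. (In robust phase retrieval, $\{1,\dots,m\}$ is the disjoint union of $\mathbb{I}_1,\mathbb{I}_2$, $b_i=(a_i^\top x_\star)^2$ for $i\in\mathbb{I}_1$ with a true signal $x_\star\in\mathbb{R}^n$, and $b_i=\xi_i$ is arbitrary noise for $i\in\mathbb{I}_2$.) Put $c(x)=|Ax|^2-b$, where $|\cdot|^2$ is the entrywise square, $h(z)=\frac1m\|z\|_1$, and $$F(x)=h(c(x))=\frac1m\sum_{i=1}^m|(a_i^\top x)^2-b_i|.$$ $\nabla c(y)=2\,\mathrm{diag}(Ay)A$ is the Jacobian of $c$, and $L=\frac2m\|A\|_2^2$ with $\|A\|_2$ the spectral norm. For $t>0$ define $F(z;y)=h(c(y)+\nabla c(y)(z-y))$, $F_t(z;y)=F(z;y)+\frac1{2t}\|z-y\|_2^2$, $S_t(y)=\arg\min_{x\in\mathbb{R}^n}F_t(x;y)$ (unique by strong convexity), and $\mathcal{G}_t(x)=t^{-1}(x-S_t(x))$. A point $\tilde x$ is an $\epsilon$-stationary point if $\|\mathcal{G}_t(\tilde x)\|_2\le\epsilon$. $\mathbb{N}$ includes $0$. *)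

theory Defs
  imports "HOL-Analysis.Analysis"
begin

text \<open>
  The type variables \<open>'m\<close> and \<open>'n\<close> index measurements and coordinates, so \<open>m = CARD('m)\<close>,
  \<open>n = CARD('n)\<close>, and the measurement vector \<open>a\<^sub>i\<close> is the row \<open>A $ i\<close>. Norms on
  \<open>real ^ 'n\<close> and \<open>real ^ 'm\<close> are Euclidean, hence \<open>onorm ((*v) A)\<close> is the spectral norm of \<open>A\<close>.
\<close>

definition l1_norm :: "real ^ 'm \<Rightarrow> real" where
  "l1_norm z = (\<Sum>i\<in>UNIV. \<bar>z $ i\<bar>)"

definition h_mean :: "real ^ 'm \<Rightarrow> real" where
  "h_mean z = 1 / real CARD('m) * l1_norm z"

definition c_map :: "real ^ 'n ^ 'm \<Rightarrow> real ^ 'm \<Rightarrow> real ^ 'n \<Rightarrow> real ^ 'm" where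
  "c_map A b x = (\<chi> i. \<bar>(A *v x) $ i\<bar>\<^sup>2) - b"

definition F_obj :: "real ^ 'n ^ 'm \<Rightarrow> real ^ 'm \<Rightarrow> real ^ 'n \<Rightarrow> real" where
  "F_obj A b x = h_mean (c_map A b x)"

definition F_star :: "real ^ 'n ^ 'm \<Rightarrow> real ^ 'm \<Rightarrow> real" where
  "F_star A b = (INF x. F_obj A b x)"

definition diag_matrix :: "real ^ 'm \<Rightarrow> real ^ 'm ^ 'm" where
  "diag_matrix v = (\<chi> i j. if i = j then v $ i else 0)"

definition jac_c :: "real ^ 'n ^ 'm \<Rightarrow> real ^ 'n \<Rightarrow> real ^ 'n ^ 'm" where
  "jac_c A y = 2 *\<^sub>R (diag_matrix (A *v y) ** A)"

definition lip_const :: "real ^ 'n ^ 'm \<Rightarrow> real" where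
  "lip_const A = 2 / real CARD('m) * (onorm ((*v) A))\<^sup>2"

definition F_lin :: "real ^ 'n ^ 'm \<Rightarrow> real ^ 'm \<Rightarrow> real ^ 'n \<Rightarrow> real ^ 'n \<Rightarrow> real" where
  "F_lin A b z y = h_mean (c_map A b y + jac_c A y *v (z - y))"

definition F_prox :: "real ^ 'n ^ 'm \<Rightarrow> real ^ 'm \<Rightarrow> real \<Rightarrow> real ^ 'n \<Rightarrow> real ^ 'n \<Rightarrow> real" where
  "F_prox A b t z y = F_lin A b z y + 1 / (2 * t) * (norm (z - y))\<^sup>2"

text \<open>
  For \<open>t > 0\<close> the minimiser exists and is unique, and the infimum below is attained there;
  see \<open>F_prox_ex1_arg_min\<close> and \<open>F_prox_min_eq\<close>.
\<close>

definition S_prox :: "real ^ 'n ^ 'm \<Rightarrow> real ^ 'm \<Rightarrow> real \<Rightarrow> real ^ 'n \<Rightarrow> real ^ 'n" where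
  "S_prox A b t y = arg_min (\<lambda>x. F_prox A b t x y) (\<lambda>_. True)"

definition F_prox_min :: "real ^ 'n ^ 'm \<Rightarrow> real ^ 'm \<Rightarrow> real \<Rightarrow> real ^ 'n \<Rightarrow> real" where
  "F_prox_min A b t y = (INF x. F_prox A b t x y)"

definition G_map :: "real ^ 'n ^ 'm \<Rightarrow> real ^ 'm \<Rightarrow> real \<Rightarrow> real ^ 'n \<Rightarrow> real ^ 'n" where
  "G_map A b t x = (1 / t) *\<^sub>R (x - S_prox A b t x)"

definition eps_stationary ::
  "real ^ 'n ^ 'm \<Rightarrow> real ^ 'm \<Rightarrow> real \<Rightarrow> real \<Rightarrow> real ^ 'n \<Rightarrow> bool" where
  "eps_stationary A b t \<epsilon> x \<longleftrightarrow> norm (G_map A b t x) \<le> \<epsilon>"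

lemma F_obj_eq: "F_obj A b x = 1 / real CARD('m) * (\<Sum>i\<in>UNIV. \<bar>((A $ i) \<bullet> x)\<^sup>2 - b $ i\<bar>)"
  for A :: "real ^ 'n ^ 'm"
  by (simp add: F_obj_def h_mean_def l1_norm_def c_map_def matrix_vector_mul_component)

lemma jac_c_nth: "(jac_c A y *v d) $ i = 2 * ((A *v y) $ i) * ((A *v d) $ i)"
proof -
  have "jac_c A y *v d = 2 *\<^sub>R (diag_matrix (A *v y) *v (A *v d))"
    by (simp add: jac_c_def scaleR_matrix_vector_assoc matrix_vector_mul_assoc)
  then show ?thesis
    by (simp add: diag_matrix_def matrix_vector_mult_def[of "\<chi> i j. _ i j"] if_distrib
        if_distribR sum.delta cong: if_cong)
qed

lemma c_map_has_derivative: "(c_map A b has_derivative (\<lambda>d. jac_c A y *v d)) (at y)"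
proof -
  have 1: "((\<lambda>x. (A *v x) $ i) has_derivative (\<lambda>d. (A *v d) $ i)) (at y)" for i
    by (intro bounded_linear_imp_has_derivative
        bounded_linear_compose[OF bounded_linear_vec_nth matrix_vector_mul_bounded_linear])
  have "((\<lambda>x. c_map A b x $ i) has_derivative (\<lambda>d. (jac_c A y *v d) $ i)) (at y)" for i
    unfolding jac_c_nth c_map_def
    by (auto intro!: derivative_eq_intros 1 simp: mult_ac)
  then show ?thesis
    by (subst has_derivative_componentwise_within)
       (auto simp: Basis_vec_def inner_axis)
qed

lemma h_mean_nonneg: "0 \<le> h_mean z"
  by (simp add: h_mean_def l1_norm_def sum_nonneg)

lemma h_mean_midpoint: "h_mean ((1/2) *\<^sub>R (u + v)) \<le> (h_mean u + h_mean v) / 2"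
proof -
  have "l1_norm ((1/2) *\<^sub>R (u + v)) \<le> (\<Sum>i\<in>UNIV. (\<bar>u $ i\<bar> + \<bar>v $ i\<bar>) / 2)"
    unfolding l1_norm_def
  proof (rule sum_mono)
    fix i
    have "((1/2) *\<^sub>R (u + v)) $ i = (u $ i + v $ i) / 2"
      by simp
    then show "\<bar>((1/2) *\<^sub>R (u + v)) $ i\<bar> \<le> (\<bar>u $ i\<bar> + \<bar>v $ i\<bar>) / 2"
      using abs_triangle_ineq[of "u $ i" "v $ i"] by simp
  qed
  also have "\<dots> = (l1_norm u + l1_norm v) / 2"
    by (simp add: l1_norm_def sum.distrib flip: sum_divide_distrib)
  finally show ?thesis
    by (simp add: h_mean_def field_simps)
qed

lemma F_prox_continuous: "continuous_on UNIV (\<lambda>x. F_prox A b t x y)"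
  unfolding F_prox_def F_lin_def h_mean_def l1_norm_def
  by (intro continuous_intros bounded_linear.continuous_on[OF matrix_vector_mul_bounded_linear])

lemma F_prox_ex_min:
  assumes "t > 0"
  shows "\<exists>x. \<forall>z. F_prox A b t x y \<le> F_prox A b t z y"
proof -
  define M where "M = F_prox A b t y y"
  define r where "r = sqrt (2 * t * M)"
  have M: "0 \<le> M"
    by (simp add: M_def F_prox_def F_lin_def h_mean_nonneg)
  have r: "0 \<le> r" "r\<^sup>2 = 2 * t * M"
    using M assms by (auto simp: r_def)
  have "\<exists>x\<in>cball y r. \<forall>z\<in>cball y r. F_prox A b t x y \<le> F_prox A b t z y"
    using r by (intro continuous_attains_inf continuous_on_subset[OF F_prox_continuous]) auto
  then obtain x where x: "\<And>z. z \<in> cball y r \<Longrightarrow> F_prox A b t x y \<le> F_prox A b t z y"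
    by blast
  have "F_prox A b t x y \<le> F_prox A b t z y" for z
  proof (cases "z \<in> cball y r")
    case False
    then have "r \<le> norm (z - y)"
      by (simp add: dist_norm norm_minus_commute)
    then have "2 * t * M \<le> (norm (z - y))\<^sup>2"
      using r by (metis power_mono)
    then have "M \<le> 1 / (2 * t) * (norm (z - y))\<^sup>2"
      using assms by (simp add: field_simps)
    also have "\<dots> \<le> F_prox A b t z y"
      by (simp add: F_prox_def F_lin_def h_mean_nonneg)
    finally show ?thesis
      using x[of y] r by (simp add: M_def)
  qed (rule x)
  then show ?thesis by blast
qed

lemma F_prox_midpoint:
  fixes A :: "real ^ 'n ^ 'm"
  assumes "t > 0"
  shows "F_prox A b t ((1/2) *\<^sub>R (u + v)) y
    \<le> (F_prox A b t u y + F_prox A b t v y) / 2 - 1 / (8 * t) * (norm (u - v))\<^sup>2"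
proof -
  let ?w = "(1/2) *\<^sub>R (u + v)"
  have eq: "?w - y = (1/2) *\<^sub>R ((u - y) + (v - y))"
    by (simp add: vec_eq_iff field_simps)
  have "c_map A b y + jac_c A y *v (?w - y) =
      (1/2) *\<^sub>R ((c_map A b y + jac_c A y *v (u - y)) + (c_map A b y + jac_c A y *v (v - y)))"
    unfolding eq matrix_vector_mult_scaleR matrix_vector_right_distrib
    by (simp add: vec_eq_iff field_simps)
  then have 1: "F_lin A b ?w y \<le> (F_lin A b u y + F_lin A b v y) / 2"
    using h_mean_midpoint unfolding F_lin_def by metis
  have pl: "(norm (p + q))\<^sup>2 + (norm (p - q))\<^sup>2 = 2 * (norm p)\<^sup>2 + 2 * (norm q)\<^sup>2"
    for p q :: "real ^ 'n"
    by (simp add: power2_norm_eq_inner inner_add_left inner_add_right inner_diff_left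
        inner_diff_right)
  have diff_eq: "(u - y) - (v - y) = u - v"
    by simp
  have 2: "(norm (?w - y))\<^sup>2 =
      ((norm (u - y))\<^sup>2 + (norm (v - y))\<^sup>2) / 2 - (norm (u - v))\<^sup>2 / 4"
  proof -
    have half: "(norm (?w - y))\<^sup>2 = (norm ((u - y) + (v - y)))\<^sup>2 / 4"
      unfolding eq norm_scaleR by (simp add: power_mult_distrib power_divide)
    have quarter: "r / 4 = (p + q) / 2 - s / 4" if "r + s = 2 * p + 2 * q" for p q r s :: real
      using that by (simp add: field_simps)
    show ?thesis
      using half quarter[OF pl[of "u - y" "v - y"]] unfolding diff_eq by (rule trans)
  qed
  have "1 / (2 * t) * ((p + q) / 2 - s / 4) =
      (1 / (2 * t) * p + 1 / (2 * t) * q) / 2 - 1 / (8 * t) * s" for p q s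
    using assms by (simp add: field_simps)
  with 1 show ?thesis
    unfolding F_prox_def 2 by (simp add: add_divide_distrib)
qed

lemma F_prox_ex1_arg_min:
  assumes "t > 0"
  shows "\<exists>!x. is_arg_min (\<lambda>x. F_prox A b t x y) (\<lambda>_. True) x"
proof (rule ex_ex1I)
  show "\<exists>x. is_arg_min (\<lambda>x. F_prox A b t x y) (\<lambda>_. True) x"
    using F_prox_ex_min[OF assms] by (simp add: is_arg_min_linorder)
next
  fix u v
  assume "is_arg_min (\<lambda>x. F_prox A b t x y) (\<lambda>_. True) u"
    and "is_arg_min (\<lambda>x. F_prox A b t x y) (\<lambda>_. True) v"
  then have "F_prox A b t u y \<le> F_prox A b t ((1/2) *\<^sub>R (u + v)) y"
    and "F_prox A b t v y \<le> F_prox A b t ((1/2) *\<^sub>R (u + v)) y"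
    by (auto simp: is_arg_min_linorder)
  moreover have "q \<le> 0" if "a \<le> w" "d \<le> w" "w \<le> (a + d) / 2 - q" for a d w q :: real
    using that by (simp add: field_simps)
  ultimately have "1 / (8 * t) * (norm (u - v))\<^sup>2 \<le> 0"
    using F_prox_midpoint[OF assms, of A b u v y] by blast
  then show "u = v"
    using assms by (simp add: divide_le_0_iff)
qed

lemma S_prox_is_arg_min:
  assumes "t > 0"
  shows "is_arg_min (\<lambda>x. F_prox A b t x y) (\<lambda>_. True) (S_prox A b t y)"
  unfolding S_prox_def arg_min_def
  using F_prox_ex1_arg_min[OF assms] by (rule someI2_ex[OF ex1_implies_ex])

lemma F_prox_min_eq:
  assumes "t > 0"
  shows "F_prox_min A b t y = F_prox A b t (S_prox A b t y) y"
  unfolding F_prox_min_def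
  using S_prox_is_arg_min[OF assms, of A b y]
  by (intro cInf_eq_minimum) (auto simp: is_arg_min_linorder)

end

theory Submission
  imports Defs
begin

text \<open>
  The remainder of the linearisation of \<open>c\<close> at \<open>y\<close> is \<open>|A(z - y)|\<^sup>2\<close>, so \<open>t = 1/L\<close> makes
  \<open>F\<^sub>t(\<cdot>; y)\<close> an upper model of \<open>F\<close> that is exact at \<open>y\<close>. By strong convexity the optimal
  model decrease at \<open>y\<close> is at least \<open>t/2 \<parallel>G\<^sub>t(y)\<parallel>\<^sup>2\<close>. Either inexactness condition preserves a
  fixed fraction of this decrease, so \<open>F(x\<^sup>k) - F(x\<^sup>k\<^sup>+\<^sup>1)\<close> is at least a multiple of
  \<open>\<parallel>G\<^sub>t(x\<^sup>k)\<parallel>\<^sup>2\<close>, and the bounds follow by telescoping.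
\<close>

section \<open>Sublinearity of the mean and the upper model of the objective\<close>

lemma h_mean_triangle: "h_mean (u + v) \<le> h_mean u + h_mean v"
proof -
  have "l1_norm (u + v) \<le> l1_norm u + l1_norm v"
    by (simp add: l1_norm_def abs_triangle_ineq sum_mono flip: sum.distrib)
  then show ?thesis
    by (simp add: h_mean_def divide_right_mono flip: add_divide_distrib)
qed

lemma h_mean_scaleR: "h_mean (r *\<^sub>R u) = \<bar>r\<bar> * h_mean u"
  by (simp add: h_mean_def l1_norm_def abs_mult flip: sum_distrib_left)

lemma lip_const_pos:
  assumes "A \<noteq> 0"
  shows "0 < lip_const A"
proof -
  have "onorm ((*v) A) \<noteq> 0"
    using assms by (auto simp: onorm_eq_0 matrix_eq)
  then show ?thesis by (simp add: lip_const_def)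
qed

lemma c_map_linearization_error:
  "c_map A b z - (c_map A b y + jac_c A y *v (z - y)) = (\<chi> i. ((A *v (z - y)) $ i)\<^sup>2)"
  by (simp add: vec_eq_iff jac_c_nth c_map_def matrix_vector_mult_diff_distrib
      power2_eq_square algebra_simps)

lemma F_obj_le_F_prox:
  fixes A :: "real ^ 'n ^ 'm"
  assumes "t = 1 / lip_const A"
  shows "F_obj A b z \<le> F_prox A b t z y"
proof -
  let ?e = "\<chi> i. ((A *v (z - y)) $ i)\<^sup>2"
  have "F_obj A b z = h_mean ((c_map A b y + jac_c A y *v (z - y)) + ?e)"
    by (simp add: F_obj_def flip: c_map_linearization_error[of A b z y])
  also have "\<dots> \<le> F_lin A b z y + h_mean ?e"
    unfolding F_lin_def by (rule h_mean_triangle)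
  finally have 1: "F_obj A b z \<le> F_lin A b z y + h_mean ?e" .
  \<comment> \<open>The entries of \<open>?e\<close> are squares, so its l1 norm is the squared
    Euclidean norm of \<open>A *v (z - y)\<close>.\<close>
  have "h_mean ?e = (norm (A *v (z - y)))\<^sup>2 / real CARD('m)"
    unfolding power2_norm_eq_inner
    by (simp add: h_mean_def l1_norm_def inner_vec_def power2_eq_square)
  also have "\<dots> \<le> (onorm ((*v) A) * norm (z - y))\<^sup>2 / real CARD('m)"
    by (intro divide_right_mono power_mono onorm matrix_vector_mul_bounded_linear) auto
  \<comment> \<open>This fixes the factor 2 in \<open>lip_const\<close>: \<open>1 / (2 * t)\<close>
    is half of it, that is, the squared spectral norm over m.\<close>
  also have "\<dots> = 1 / (2 * t) * (norm (z - y))\<^sup>2"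
    by (simp add: assms lip_const_def power_mult_distrib)
  finally show ?thesis
    using 1 by (simp add: F_prox_def)
qed

lemma F_prox_self: "F_prox A b t y y = F_obj A b y"
  by (simp add: F_prox_def F_lin_def F_obj_def)

section \<open>Strong convexity and quadratic growth of the model\<close>

lemma F_lin_convex:
  assumes "0 \<le> r" "r \<le> 1"
  shows "F_lin A b ((1 - r) *\<^sub>R u + r *\<^sub>R v) y \<le> (1 - r) * F_lin A b u y + r * F_lin A b v y"
proof -
  have eq: "(1 - r) *\<^sub>R u + r *\<^sub>R v - y = (1 - r) *\<^sub>R (u - y) + r *\<^sub>R (v - y)"
    by (simp add: algebra_simps)
  have "c_map A b y + jac_c A y *v ((1 - r) *\<^sub>R u + r *\<^sub>R v - y) =
      (1 - r) *\<^sub>R (c_map A b y + jac_c A y *v (u - y)) + r *\<^sub>R (c_map A b y + jac_c A y *v (v - y))"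
    unfolding eq matrix_vector_mult_scaleR matrix_vector_right_distrib
    by (simp add: algebra_simps)
  then have "F_lin A b ((1 - r) *\<^sub>R u + r *\<^sub>R v) y \<le>
      h_mean ((1 - r) *\<^sub>R (c_map A b y + jac_c A y *v (u - y))) +
      h_mean (r *\<^sub>R (c_map A b y + jac_c A y *v (v - y)))"
    unfolding F_lin_def by (metis h_mean_triangle)
  then show ?thesis
    using assms by (simp add: F_lin_def h_mean_scaleR)
qed

lemma norm_convex_combination_sq:
  fixes p q :: "'a::real_inner"
  shows "(norm ((1 - r) *\<^sub>R p + r *\<^sub>R q))\<^sup>2 =
    (1 - r) * (norm p)\<^sup>2 + r * (norm q)\<^sup>2 - r * (1 - r) * (norm (q - p))\<^sup>2"
  by (simp add: power2_norm_eq_inner inner_add_left inner_add_right inner_diff_left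
      inner_diff_right inner_commute[of q p] algebra_simps)

text \<open>\<open>F_lin\<close> is convex and the proximal term satisfies the inequality with
  equality. General weights are needed: \<open>F_prox_midpoint\<close> would yield quadratic growth
  with only half the constant \<open>1 / (2 * t)\<close>.\<close>

lemma F_prox_strongly_convex:
  assumes "0 \<le> r" "r \<le> 1"
  shows "F_prox A b t ((1 - r) *\<^sub>R u + r *\<^sub>R v) y \<le>
    (1 - r) * F_prox A b t u y + r * F_prox A b t v y
      - r * (1 - r) * (1 / (2 * t) * (norm (v - u))\<^sup>2)"
proof -
  have eq: "(1 - r) *\<^sub>R u + r *\<^sub>R v - y = (1 - r) *\<^sub>R (u - y) + r *\<^sub>R (v - y)"
    by (simp add: algebra_simps)
  have norm_sq: "(norm ((1 - r) *\<^sub>R u + r *\<^sub>R v - y))\<^sup>2 =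
      (1 - r) * (norm (u - y))\<^sup>2 + r * (norm (v - y))\<^sup>2 - r * (1 - r) * (norm (v - u))\<^sup>2"
    unfolding eq norm_convex_combination_sq by simp
  have "1 / (2 * t) * (norm ((1 - r) *\<^sub>R u + r *\<^sub>R v - y))\<^sup>2 =
      (1 - r) * (1 / (2 * t) * (norm (u - y))\<^sup>2) + r * (1 / (2 * t) * (norm (v - y))\<^sup>2)
        - r * (1 - r) * (1 / (2 * t) * (norm (v - u))\<^sup>2)"
    unfolding norm_sq by (simp only: algebra_simps)
  with F_lin_convex[OF assms, of A b u v y] show ?thesis
    unfolding F_prox_def by (simp only: distrib_left)
qed

text \<open>Compare the minimiser with a point at fraction r of the segment towards
  \<open>v\<close>, divide by r and let r tend to 0.\<close>

lemma F_prox_quadratic_growth: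
  assumes "0 < t"
  shows "F_prox_min A b t y + 1 / (2 * t) * (norm (v - S_prox A b t y))\<^sup>2 \<le> F_prox A b t v y"
proof -
  let ?s = "S_prox A b t y" and ?q = "1 / (2 * t) * (norm (v - S_prox A b t y))\<^sup>2"
  have "?q \<le> F_prox A b t v y - F_prox A b t ?s y"
  \<comment> \<open>This rule replaces the limit: a bound on \<open>z * ?q\<close> for every
    \<open>z = 1 - r\<close> in (0, 1) suffices.\<close>
  proof (rule field_le_mult_one_interval)
    fix z :: real
    assume z: "0 < z" "z < 1"
    define r where "r = 1 - z"
    have r: "0 < r" "r \<le> 1" "z = 1 - r"
      using z by (auto simp: r_def)
    have "F_prox A b t ?s y \<le> F_prox A b t ((1 - r) *\<^sub>R ?s + r *\<^sub>R v) y"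
      using S_prox_is_arg_min[OF assms, of A b y] by (simp add: is_arg_min_linorder)
    also have "\<dots> \<le> (1 - r) * F_prox A b t ?s y + r * F_prox A b t v y - r * (1 - r) * ?q"
      using r by (intro F_prox_strongly_convex) auto
    finally have "r * (z * ?q) \<le> r * (F_prox A b t v y - F_prox A b t ?s y)"
      unfolding r(3) by (simp only: algebra_simps)
    then show "z * ?q \<le> F_prox A b t v y - F_prox A b t ?s y"
      using r(1) by (simp only: mult_le_cancel_left_pos)
  qed
  then show ?thesis
    by (simp add: F_prox_min_eq[OF assms])
qed

section \<open>Decrease per iteration and iteration counting\<close>

lemma norm_G_map:
  assumes "0 < t"
  shows "norm (x - S_prox A b t x) = t * norm (G_map A b t x)"
  using assms by (simp add: G_map_def)

lemma F_star_le: "F_star A b \<le> F_obj A b x"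
  unfolding F_star_def
  by (rule cINF_lower) (auto intro!: bdd_belowI[of _ 0] simp: F_obj_def h_mean_nonneg)

text \<open>Stated for abstract sequences so that both inexactness conditions can use it, each with
  its own \<open>c\<close>.\<close>

lemma sufficient_decrease_complexity:
  fixes f g :: "nat \<Rightarrow> real"
  assumes lower: "\<And>k. l \<le> f k"
    and decrease: "\<And>k. c * (g k)\<^sup>2 \<le> f k - f (Suc k)"
    and "0 < c" "0 < \<epsilon>"
  shows "\<exists>k. int k \<le> \<lfloor>(f 0 - l) / (c * \<epsilon>\<^sup>2)\<rfloor> \<and> g k \<le> \<epsilon>"
proof (rule ccontr)
  define N where "N = nat \<lfloor>(f 0 - l) / (c * \<epsilon>\<^sup>2)\<rfloor>"
  \<comment> \<open>Nonnegativity ensures that \<open>nat\<close> does not truncate the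
    floor.\<close>
  have "0 \<le> (f 0 - l) / (c * \<epsilon>\<^sup>2)"
    using assms lower[of 0] by simp
  then have N: "int N = \<lfloor>(f 0 - l) / (c * \<epsilon>\<^sup>2)\<rfloor>"
    by (simp add: N_def)
  assume "\<nexists>k. int k \<le> \<lfloor>(f 0 - l) / (c * \<epsilon>\<^sup>2)\<rfloor> \<and> g k \<le> \<epsilon>"
  then have big: "\<epsilon> < g k" if "k \<le> N" for k
    using that N by (metis not_le of_nat_le_iff)
  \<comment> \<open>The indices 0 to \<open>N\<close> give \<open>N + 1\<close> decreases, one more
    than the floor allows.\<close>
  have "real (Suc N) * (c * \<epsilon>\<^sup>2) = (\<Sum>k<Suc N. c * \<epsilon>\<^sup>2)"
    by simp
  also have "\<dots> \<le> (\<Sum>k<Suc N. f k - f (Suc k))"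
  proof (rule sum_mono)
    fix k
    assume "k \<in> {..<Suc N}"
    then have "\<epsilon>\<^sup>2 \<le> (g k)\<^sup>2"
      using big[of k] \<open>0 < \<epsilon>\<close> by (intro power_mono) auto
    then have "c * \<epsilon>\<^sup>2 \<le> c * (g k)\<^sup>2"
      using \<open>0 < c\<close> by simp
    then show "c * \<epsilon>\<^sup>2 \<le> f k - f (Suc k)"
      using decrease[of k] by simp
  qed
  also have "\<dots> = f 0 - f (Suc N)"
    by (rule sum_lessThan_telescope')
  also have "\<dots> \<le> f 0 - l"
    using lower[of "Suc N"] by simp
  finally have "real (Suc N) \<le> (f 0 - l) / (c * \<epsilon>\<^sup>2)"
    using \<open>0 < c\<close> \<open>0 < \<epsilon>\<close> by (simp add: pos_le_divide_eq)
  then have "int (Suc N) \<le> \<lfloor>(f 0 - l) / (c * \<epsilon>\<^sup>2)\<rfloor>"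
    by (simp add: le_floor_iff)
  then show False
    using N by simp
qed

lemma relative_decrease_step:
  assumes t: "t = 1 / lip_const A" "0 < t" and "0 < \<rho>"
    and inexact: "F_prox A b t z y - F_prox_min A b t y
      \<le> \<rho> * (F_prox A b t y y - F_prox A b t z y)"
  shows "t / (2 * (1 + \<rho>)) * (norm (G_map A b t y))\<^sup>2 \<le> F_obj A b y - F_obj A b z"
proof -
  have "t / 2 * (norm (G_map A b t y))\<^sup>2 = 1 / (2 * t) * (norm (y - S_prox A b t y))\<^sup>2"
    using t(2) by (simp add: norm_G_map power_mult_distrib power2_eq_square)
  also have "\<dots> \<le> F_prox A b t y y - F_prox_min A b t y"
    using F_prox_quadratic_growth[OF t(2), of A b y y] by simp
  \<comment> \<open>Adding the achieved decrease to both sides of the inexactness condition bounds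
    the optimal decrease.\<close>
  also have "\<dots> \<le> (1 + \<rho>) * (F_prox A b t y y - F_prox A b t z y)"
    using inexact by (simp add: algebra_simps)
  also have "\<dots> \<le> (1 + \<rho>) * (F_obj A b y - F_obj A b z)"
    using \<open>0 < \<rho>\<close> F_obj_le_F_prox[OF t(1), of b z y]
    by (intro mult_left_mono) (auto simp: F_prox_self)
  finally show ?thesis
    using \<open>0 < \<rho>\<close> by (simp add: field_simps)
qed

text \<open>Growth at \<open>z\<close> places \<open>z\<close> within \<open>\<sigma> * d\<close> of
  the minimiser, so \<open>d \<le> s / (1 - \<sigma>)\<close>. The model decrease is at least
  \<open>(s^2 - \<rho> * d^2) / (2 * t)\<close>, which leaves the fraction \<open>1 - \<rho> / (1 -
  \<sigma>)^2 = (1 - 2 * \<sigma>) / (1 - \<sigma>)^2\<close> of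
  \<open>s^2 / (2 * t)\<close>.\<close>

lemma relative_distance_step:
  assumes t: "t = 1 / lip_const A" "0 < t" and \<rho>: "0 < \<rho>" "\<rho> < 1 / 4"
    and inexact: "F_prox A b t z y - F_prox_min A b t y \<le> \<rho> / (2 * t) * (norm (z - y))\<^sup>2"
  shows "(1 - 2 * sqrt \<rho>) * t / (2 * (1 - sqrt \<rho>)\<^sup>2) * (norm (G_map A b t y))\<^sup>2
    \<le> F_obj A b y - F_obj A b z"
proof -
  define \<sigma> where "\<sigma> = sqrt \<rho>"
  define d where "d = norm (z - y)"
  define s where "s = norm (y - S_prox A b t y)"
  have \<sigma>: "0 < \<sigma>" "\<sigma>\<^sup>2 = \<rho>" "\<sigma> < 1"
    using \<rho> by (auto simp: \<sigma>_def)
  have "1 / (2 * t) * (norm (z - S_prox A b t y))\<^sup>2 \<le> 1 / (2 * t) * (\<sigma> * d)\<^sup>2"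
    using F_prox_quadratic_growth[OF t(2), of A b y z] inexact
    by (simp add: power_mult_distrib \<sigma>(2) d_def)
  then have "(norm (z - S_prox A b t y))\<^sup>2 \<le> (\<sigma> * d)\<^sup>2"
    using t(2) by (simp add: divide_le_cancel)
  then have "norm (z - S_prox A b t y) \<le> \<sigma> * d"
    by (rule power2_le_imp_le) (use \<sigma>(1) in \<open>simp add: d_def\<close>)
  moreover have "d \<le> norm (z - S_prox A b t y) + s"
    unfolding d_def s_def using norm_triangle_ineq4[of "z - S_prox A b t y" "y - S_prox A b t y"]
    by simp
  ultimately have "(1 - \<sigma>) * d \<le> s"
    by (simp add: algebra_simps)
  then have "((1 - \<sigma>) * d)\<^sup>2 \<le> s\<^sup>2"
    using \<sigma>(3) by (intro power_mono) (auto simp: d_def)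
  then have "\<rho> * ((1 - \<sigma>) * d)\<^sup>2 \<le> \<rho> * s\<^sup>2"
    using \<rho> by simp
  \<comment> \<open>Uses \<open>(1 - \<sigma>)^2 - \<sigma>^2 = 1 - 2 * \<sigma>\<close>.\<close>
  then have "(1 - 2 * \<sigma>) * s\<^sup>2 \<le> (1 - \<sigma>)\<^sup>2 * (s\<^sup>2 - \<rho> * d\<^sup>2)"
    unfolding \<sigma>(2)[symmetric] by (simp add: power2_eq_square algebra_simps)
  then have "(1 - 2 * \<sigma>) / (1 - \<sigma>)\<^sup>2 * s\<^sup>2 \<le> s\<^sup>2 - \<rho> * d\<^sup>2"
    using \<sigma>(3) by (simp add: pos_divide_le_eq mult.commute)
  then have "1 / (2 * t) * ((1 - 2 * \<sigma>) / (1 - \<sigma>)\<^sup>2 * s\<^sup>2) \<le> 1 / (2 * t) * (s\<^sup>2 - \<rho> * d\<^sup>2)"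
    using t(2) by (intro mult_left_mono) auto
  also have "\<dots> \<le> F_prox A b t y y - F_prox A b t z y"
    using F_prox_quadratic_growth[OF t(2), of A b y y] inexact
    by (simp add: s_def d_def diff_divide_distrib)
  also have "\<dots> \<le> F_obj A b y - F_obj A b z"
    using F_obj_le_F_prox[OF t(1), of b z y] by (simp add: F_prox_self)
  finally have "1 / (2 * t) * ((1 - 2 * \<sigma>) / (1 - \<sigma>)\<^sup>2 * s\<^sup>2) \<le> F_obj A b y - F_obj A b z" .
  moreover have "s = t * norm (G_map A b t y)"
    using t(2) by (simp add: s_def norm_G_map)
  then have "(1 - 2 * \<sigma>) * t / (2 * (1 - \<sigma>)\<^sup>2) * (norm (G_map A b t y))\<^sup>2 =
      1 / (2 * t) * ((1 - 2 * \<sigma>) / (1 - \<sigma>)\<^sup>2 * s\<^sup>2)"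
    using t(2) by (simp add: power_mult_distrib power2_eq_square[of t])
  ultimately show ?thesis
    unfolding \<sigma>_def by (simp only:)
qed

theorem theorem1:
  fixes A :: "real ^ 'n ^ 'm"
    and b :: "real ^ 'm"
    and t :: real
    and x0 :: "real ^ 'n"
  assumes "A \<noteq> 0"
    and "t = 1 / lip_const A"
  shows "(\<forall>(\<rho>l::real) (x :: nat \<Rightarrow> real ^ 'n).
            \<rho>l > 0 \<longrightarrow> x 0 = x0 \<longrightarrow>
            (\<forall>k. F_prox A b t (x (Suc k)) (x k) - F_prox_min A b t (x k)
                 \<le> \<rho>l * (F_prox A b t (x k) (x k) - F_prox A b t (x (Suc k)) (x k))) \<longrightarrow>
            (\<forall>\<epsilon>>0. \<exists>k. int k \<le> \<lfloor>2 * (1 + \<rho>l) * (F_obj A b x0 - F_star A b) / (t * \<epsilon>\<^sup>2)\<rfloor> \<and>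
                 eps_stationary A b t \<epsilon> (x k)))
       \<and> (\<forall>(\<rho>h::real) (x :: nat \<Rightarrow> real ^ 'n).
            0 < \<rho>h \<longrightarrow> \<rho>h < 1 / 4 \<longrightarrow> x 0 = x0 \<longrightarrow>
            (\<forall>k. F_prox A b t (x (Suc k)) (x k) - F_prox_min A b t (x k)
                 \<le> \<rho>h / (2 * t) * (norm (x (Suc k) - x k))\<^sup>2) \<longrightarrow>
            (\<forall>\<epsilon>>0. \<exists>k. int k \<le> \<lfloor>2 * (1 - sqrt \<rho>h)\<^sup>2 * (F_obj A b x0 - F_star A b)
                                   / ((1 - 2 * sqrt \<rho>h) * t * \<epsilon>\<^sup>2)\<rfloor> \<and>
                 eps_stationary A b t \<epsilon> (x k)))"
proof -
  have t: "0 < t"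
    using assms lip_const_pos by simp
  \<comment> \<open>\<open>B\<close> is tied to \<open>c\<close> only by an equation, so each stated
    bound unifies directly and its rearrangement is left to simplification.\<close>
  have complexity: "\<exists>k. int k \<le> \<lfloor>B\<rfloor> \<and> eps_stationary A b t \<epsilon> (x k)"
    if "0 < c" "0 < \<epsilon>" "x 0 = x0" "B = (F_obj A b x0 - F_star A b) / (c * \<epsilon>\<^sup>2)"
      and "\<And>k. c * (norm (G_map A b t (x k)))\<^sup>2 \<le> F_obj A b (x k) - F_obj A b (x (Suc k))"
    for c \<epsilon> B :: real and x :: "nat \<Rightarrow> real ^ 'n"
    using sufficient_decrease_complexity[of "F_star A b" "\<lambda>k. F_obj A b (x k)" c
        "\<lambda>k. norm (G_map A b t (x k))" \<epsilon>] that
    by (simp add: eps_stationary_def F_star_le)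
  show ?thesis
  proof (intro conjI allI impI)
    fix \<rho> \<epsilon> :: real and x :: "nat \<Rightarrow> real ^ 'n"
    assume "0 < \<rho>" "x 0 = x0" "0 < \<epsilon>"
      and "\<forall>k. F_prox A b t (x (Suc k)) (x k) - F_prox_min A b t (x k)
        \<le> \<rho> * (F_prox A b t (x k) (x k) - F_prox A b t (x (Suc k)) (x k))"
    then show "\<exists>k. int k \<le> \<lfloor>2 * (1 + \<rho>) * (F_obj A b x0 - F_star A b) / (t * \<epsilon>\<^sup>2)\<rfloor> \<and>
        eps_stationary A b t \<epsilon> (x k)"
      using t by (intro complexity[where c = "t / (2 * (1 + \<rho>))"]
          relative_decrease_step[OF assms(2) t]) auto
  next
    fix \<rho> \<epsilon> :: real and x :: "nat \<Rightarrow> real ^ 'n"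
    assume \<rho>: "0 < \<rho>" "\<rho> < 1 / 4" and x: "x 0 = x0" "0 < \<epsilon>"
      "\<forall>k. F_prox A b t (x (Suc k)) (x k) - F_prox_min A b t (x k)
        \<le> \<rho> / (2 * t) * (norm (x (Suc k) - x k))\<^sup>2"
    \<comment> \<open>Here \<open>\<rho> < 1 / 4\<close> makes the decrease constant
      positive.\<close>
    have "sqrt \<rho> < 1 / 2"
      using \<rho>(2) by (intro real_less_lsqrt) (auto simp: power2_eq_square)
    then have "0 < (1 - 2 * sqrt \<rho>) * t / (2 * (1 - sqrt \<rho>)\<^sup>2)"
      using t by (intro divide_pos_pos mult_pos_pos zero_less_power) (use \<rho> in auto)
    then show "\<exists>k. int k \<le> \<lfloor>2 * (1 - sqrt \<rho>)\<^sup>2 * (F_obj A b x0 - F_star A b)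
          / ((1 - 2 * sqrt \<rho>) * t * \<epsilon>\<^sup>2)\<rfloor> \<and> eps_stationary A b t \<epsilon> (x k)"
      using x by (intro complexity[where c = "(1 - 2 * sqrt \<rho>) * t / (2 * (1 - sqrt \<rho>)\<^sup>2)"]
          relative_distance_step[OF assms(2) t \<rho>]) auto
  qed
qed

end
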